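(* For all integers $n,m\ge 0$, the bicomplex Pell numbers $BP_n$ and $BP_m$ satisfy $$(BP_n\times BP_m)_i^*=(BP_m)_i^*\times(BP_n)_i^*=(BP_n)_i^*\times(BP_m)_i^*,$$ $$(BP_n\times BP_m)_j^*=(BP_m)_j^*\times(BP_n)_j^*=(BP_n)_j^*\times(BP_m)_j^*,$$ $$(BP_n\times BP_m)_{ij}^*=(BP_m)_{ij}^*\times(BP_n)_{ij}^*=(BP_n)_{ij}^*\times(BP_m)_{ij}^*.$$
   Context: The bicomplex numbers $\mathbb{C}_2=\{q_1+iq_2+jq_3+ijq_4 : q_1,q_2,q_3,q_4\in\mathbb{R}\}$ form the commutative associative real algebra with basis $1,i,j,ij$ and multiplication (denoted $\times$ or by juxtaposition) determined by $i^2=-1$, $j^2=-1$, $ij=ji$ (so $(ij)^2=1$). For $q=q_1+iq_2+jq_3+ijq_4$ the three conjugations are $q_i^*=q_1-iq_2+jq_3-ijq_4$, $q_j^*=q_1+iq_2-jq_3-ijq_4$, $q_{ij}^*=q_1-iq_2-jq_3+ijq_4$. The Pell numbers are $P_0=0$, $P_1=1$, $P_n=2P_{n-1}+P_{n-2}$. The bicomplex Pell numbers are $BP_n=P_n+iP_{n+1}+jP_{n+2}+ijP_{n+3}$. *)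

theory Defs
  imports Complex_Main
begin

text \<open>\<open>Bicomplex q1 q2 q3 q4\<close> stands for \<open>q1 + i q2 + j q3 + ij q4\<close>; see
  \<open>bicomplex_expansion\<close> below.\<close>

codatatype bicomplex =
  Bicomplex (bc1: real) (bc2: real) (bc3: real) (bc4: real)

lemma bicomplex_eqI:
  "bc1 x = bc1 y \<Longrightarrow> bc2 x = bc2 y \<Longrightarrow> bc3 x = bc3 y \<Longrightarrow> bc4 x = bc4 y \<Longrightarrow> x = y"
  by (rule bicomplex.expand) simp

lemma bicomplex_eq_iff:
  "x = y \<longleftrightarrow> bc1 x = bc1 y \<and> bc2 x = bc2 y \<and> bc3 x = bc3 y \<and> bc4 x = bc4 y"
  by (auto intro: bicomplex_eqI)

text \<open>The product is the bilinear extension of \<open>i^2 = j^2 = -1\<close>, \<open>ij = ji\<close>, hence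
  \<open>(ij)^2 = 1\<close>, \<open>i(ij) = -j\<close> and \<open>j(ij) = -i\<close>.\<close>

instantiation bicomplex :: real_algebra_1
begin

primcorec zero_bicomplex where
  "bc1 0 = 0" | "bc2 0 = 0" | "bc3 0 = 0" | "bc4 0 = 0"

primcorec one_bicomplex where
  "bc1 1 = 1" | "bc2 1 = 0" | "bc3 1 = 0" | "bc4 1 = 0"

primcorec plus_bicomplex where
  "bc1 (x + y) = bc1 x + bc1 y"
| "bc2 (x + y) = bc2 x + bc2 y"
| "bc3 (x + y) = bc3 x + bc3 y"
| "bc4 (x + y) = bc4 x + bc4 y"

primcorec uminus_bicomplex where
  "bc1 (- x) = - bc1 x"
| "bc2 (- x) = - bc2 x"
| "bc3 (- x) = - bc3 x"
| "bc4 (- x) = - bc4 x"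

primcorec minus_bicomplex where
  "bc1 (x - y) = bc1 x - bc1 y"
| "bc2 (x - y) = bc2 x - bc2 y"
| "bc3 (x - y) = bc3 x - bc3 y"
| "bc4 (x - y) = bc4 x - bc4 y"

primcorec scaleR_bicomplex where
  "bc1 (r *\<^sub>R x) = r * bc1 x"
| "bc2 (r *\<^sub>R x) = r * bc2 x"
| "bc3 (r *\<^sub>R x) = r * bc3 x"
| "bc4 (r *\<^sub>R x) = r * bc4 x"

primcorec times_bicomplex where
  "bc1 (x * y) = bc1 x * bc1 y - bc2 x * bc2 y - bc3 x * bc3 y + bc4 x * bc4 y"
| "bc2 (x * y) = bc1 x * bc2 y + bc2 x * bc1 y - bc3 x * bc4 y - bc4 x * bc3 y"
| "bc3 (x * y) = bc1 x * bc3 y + bc3 x * bc1 y - bc2 x * bc4 y - bc4 x * bc2 y"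
| "bc4 (x * y) = bc1 x * bc4 y + bc4 x * bc1 y + bc2 x * bc3 y + bc3 x * bc2 y"

instance
  by standard (simp_all add: bicomplex_eq_iff algebra_simps)

end

instance bicomplex :: comm_ring_1
  by standard (simp_all add: bicomplex_eq_iff algebra_simps)

definition bc_i :: bicomplex where "bc_i = Bicomplex 0 1 0 0"
definition bc_j :: bicomplex where "bc_j = Bicomplex 0 0 1 0"

lemma bc_i_squared: "bc_i\<^sup>2 = -1"
  by (simp add: bicomplex_eq_iff bc_i_def power2_eq_square)

lemma bc_j_squared: "bc_j\<^sup>2 = -1"
  by (simp add: bicomplex_eq_iff bc_j_def power2_eq_square)

lemma bicomplex_expansion:
  "Bicomplex q1 q2 q3 q4 =
     of_real q1 + bc_i * of_real q2 + bc_j * of_real q3 + bc_i * bc_j * of_real q4"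
  by (simp add: bicomplex_eq_iff bc_i_def bc_j_def of_real_def)

definition conj_i :: "bicomplex \<Rightarrow> bicomplex" where
  "conj_i q = Bicomplex (bc1 q) (- bc2 q) (bc3 q) (- bc4 q)"

definition conj_j :: "bicomplex \<Rightarrow> bicomplex" where
  "conj_j q = Bicomplex (bc1 q) (bc2 q) (- bc3 q) (- bc4 q)"

definition conj_ij :: "bicomplex \<Rightarrow> bicomplex" where
  "conj_ij q = Bicomplex (bc1 q) (- bc2 q) (- bc3 q) (bc4 q)"

fun pell :: "nat \<Rightarrow> nat" where
  "pell 0 = 0"
| "pell (Suc 0) = 1"
| "pell (Suc (Suc n)) = 2 * pell (Suc n) + pell n"

definition bicomplex_pell :: "nat \<Rightarrow> bicomplex" where
  "bicomplex_pell n =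
     Bicomplex (real (pell n)) (real (pell (n + 1))) (real (pell (n + 2))) (real (pell (n + 3)))"

end

theory Submission
  imports Defs
begin

text \<open>
  Each conjugation is a ring automorphism of the bicomplex numbers: it is the real-linear map
  that replaces \<open>i\<close> by \<open>- i\<close>, or \<open>j\<close> by \<open>- j\<close>, or does both. Since
  \<open>(- i)\<^sup>2 = i\<^sup>2\<close> and \<open>(- j)\<^sup>2 = j\<^sup>2\<close>, such a replacement respects the
  defining relations of the algebra, hence products. Commutativity of the product then permits
  either order of the factors.
\<close>

lemma conj_i_mult: "conj_i (x * y) = conj_i x * conj_i y"
  by (simp add: bicomplex_eq_iff conj_i_def)

lemma conj_j_mult: "conj_j (x * y) = conj_j x * conj_j y"
  by (simp add: bicomplex_eq_iff conj_j_def)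

text \<open>Reversing the signs of both generators amounts to reversing one after the other, so
  multiplicativity passes to this conjugation by composition.\<close>

lemma conj_ij_eq_conj_i_conj_j: "conj_ij x = conj_i (conj_j x)"
  by (simp add: conj_i_def conj_j_def conj_ij_def)

lemma conj_ij_mult: "conj_ij (x * y) = conj_ij x * conj_ij y"
  by (simp add: conj_ij_eq_conj_i_conj_j conj_i_mult conj_j_mult)

theorem theorem2p1:
  fixes n m :: nat
  shows
    "(conj_i (bicomplex_pell n * bicomplex_pell m) = conj_i (bicomplex_pell m) * conj_i (bicomplex_pell n) \<and>
      conj_i (bicomplex_pell m) * conj_i (bicomplex_pell n) = conj_i (bicomplex_pell n) * conj_i (bicomplex_pell m)) \<and>
     (conj_j (bicomplex_pell n * bicomplex_pell m) = conj_j (bicomplex_pell m) * conj_j (bicomplex_pell n) \<and>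
      conj_j (bicomplex_pell m) * conj_j (bicomplex_pell n) = conj_j (bicomplex_pell n) * conj_j (bicomplex_pell m)) \<and>
     (conj_ij (bicomplex_pell n * bicomplex_pell m) = conj_ij (bicomplex_pell m) * conj_ij (bicomplex_pell n) \<and>
      conj_ij (bicomplex_pell m) * conj_ij (bicomplex_pell n) = conj_ij (bicomplex_pell n) * conj_ij (bicomplex_pell m))"
  by (simp add: conj_i_mult conj_j_mult conj_ij_mult mult.commute)

end
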